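(* Let $\mathbb{F}$ be a field, $d\ge3$, $V$ a vector space over $\mathbb{F}$ of dimension $d+1$, and $\Phi=(A;\{E_i\}_{i=0}^d;A^*;\{E^*_i\}_{i=0}^d)$ a CH system on $V$ with eigenvalue sequence $\{\theta_i\}_{i=0}^d$, dual eigenvalue sequence $\{\theta^*_i\}_{i=0}^d$ and $\Phi$-split sequence $\{\phi_i\}_{i=1}^d$. Fix a nonzero vector $u\in E_0V$ and for $0\le i\le d$ let $v^*_i=(A^*-\theta^*_{d-i+1}I)\cdots(A^*-\theta^*_{d-1}I)(A^*-\theta^*_dI)u$. Then with respect to the basis $\{v^*_{d-i}\}_{i=0}^d$ of $V$: the matrix representing $A$ is lower bidiagonal with $(i,i)$-entry $\theta_{d-i}$ $(0\le i\le d)$, $(i,i-1)$-entry $\phi_i$ $(1\le i\le d)$ and all other entries $0$; and the matrix representing $A^*$ is upper bidiagonal with $(i,i)$-entry $\theta^*_i$ $(0\le i\le d)$, $(i-1,i)$-entry $1$ $(1\le i\le d)$ and all other entries $0$.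
   Context: Rows and columns of $(d+1)\times(d+1)$ matrices are indexed by $0,\dots,d$. A matrix $M$ represents $B\in\mathrm{End}(V)$ with respect to a basis $\{w_i\}_{i=0}^d$ if $Bw_j=\sum_iM_{ij}w_i$. An element of $\mathrm{End}(V)$ is multiplicity-free if it is diagonalizable with all eigenspaces of dimension one. The primitive idempotent of a multiplicity-free $B$ for an eigenvalue $\theta$ is the $E\in\mathrm{End}(V)$ acting as the identity on the $\theta$-eigenspace and as $0$ on the other eigenspaces. A CH system on $V$ is a sequence $\Phi=(A;\{E_i\}_{i=0}^d;A^*;\{E^*_i\}_{i=0}^d)$ in $\mathrm{End}(V)$ such that: (i) $A,A^*$ are multiplicity-free; (ii) $\{E_i\}$ is an ordering of the primitive idempotents of $A$; (iii) $\{E^*_i\}$ is an ordering of the primitive idempotents of $A^*$; (iv) $E_iA^*E_j=0$ if $1<i-j$ or $1<j-i<d$, and $E_iA^*E_j\neq0$ if $i-j=1$ or $j-i=d$; (v) $E^*_iAE^*_j=0$ if $1<i-j$ or $1<j-i<d$, and $E^*_iAE^*_j\neq0$ if $i-j=1$ or $j-i=d$ $(0\le i,j\le d)$. $\theta_i$ (resp. $\theta^*_i$) is the eigenvalue of $A$ (resp. $A^*$) corresponding to $E_i$ (resp. $E^*_i$). It is known that there is a unique sequence $\{\phi_i\}_{i=1}^d$ of nonzero scalars (the $\Phi$-split sequence) such that for some basis of $V$, $A$ is represented by the lower bidiagonal matrix with $(i,i)$-entry $\theta_{d-i}$ and $(i,i-1)$-entry $1$, and $A^*$ by the upper bidiagonal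 matrix with $(i,i)$-entry $\theta^*_i$ and $(i-1,i)$-entry $\phi_i$ (all other entries $0$). It is known that $\{v^*_i\}_{i=0}^d$ is a basis of $V$. *)

theory Defs
  imports "HOL.Vector_Spaces" Main
begin

text \<open>The vector space \<open>V\<close> is the whole type on which the scalar multiplication of the locale acts,
  and \<open>End(V)\<close> consists of the maps that are linear with respect to it.\<close>

context vector_space
begin

definition ordered_basis :: "nat \<Rightarrow> (nat \<Rightarrow> 'b) \<Rightarrow> bool" where
  "ordered_basis d w \<longleftrightarrow>
     inj_on w {..d} \<and> independent (w ` {..d}) \<and> span (w ` {..d}) = UNIV"

text \<open>A \<open>(d+1) \<times> (d+1)\<close> matrix is a function of the row and column index, of which only
  the values at \<open>i, j \<le> d\<close> are used.\<close>

definition represents :: "nat \<Rightarrow> (nat \<Rightarrow> 'b) \<Rightarrow> ('b \<Rightarrow> 'b) \<Rightarrow> (nat \<Rightarrow> nat \<Rightarrow> 'a) \<Rightarrow> bool" where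
  "represents d w B M \<longleftrightarrow> (\<forall>j\<le>d. B (w j) = (\<Sum>i\<le>d. M i j *s w i))"

definition eigenspace :: "('b \<Rightarrow> 'b) \<Rightarrow> 'a \<Rightarrow> 'b set" where
  "eigenspace B \<theta> = {v. B v = \<theta> *s v}"

definition eigenvalue :: "('b \<Rightarrow> 'b) \<Rightarrow> 'a \<Rightarrow> bool" where
  "eigenvalue B \<theta> \<longleftrightarrow> (\<exists>v\<in>eigenspace B \<theta>. v \<noteq> 0)"

definition diagonalizable :: "('b \<Rightarrow> 'b) \<Rightarrow> bool" where
  "diagonalizable B \<longleftrightarrow>
     (\<exists>S. independent S \<and> span S = UNIV \<and> (\<forall>v\<in>S. \<exists>\<theta>. v \<in> eigenspace B \<theta>))"

definition multiplicity_free :: "('b \<Rightarrow> 'b) \<Rightarrow> bool" where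
  "multiplicity_free B \<longleftrightarrow>
     Vector_Spaces.linear scale scale B \<and> diagonalizable B \<and>
     (\<forall>\<theta>. eigenvalue B \<theta> \<longrightarrow> dim (eigenspace B \<theta>) = 1)"

definition primitive_idempotent :: "('b \<Rightarrow> 'b) \<Rightarrow> 'a \<Rightarrow> ('b \<Rightarrow> 'b) \<Rightarrow> bool" where
  "primitive_idempotent B \<theta> P \<longleftrightarrow>
     eigenvalue B \<theta> \<and> Vector_Spaces.linear scale scale P \<and>
     (\<forall>v\<in>eigenspace B \<theta>. P v = v) \<and>
     (\<forall>\<eta>. \<eta> \<noteq> \<theta> \<longrightarrow> (\<forall>v\<in>eigenspace B \<eta>. P v = 0))"

definition idempotent_ordering :: "nat \<Rightarrow> ('b \<Rightarrow> 'b) \<Rightarrow> (nat \<Rightarrow> 'b \<Rightarrow> 'b) \<Rightarrow> bool" where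
  "idempotent_ordering d B E \<longleftrightarrow> bij_betw E {..d} {P. \<exists>\<theta>. primitive_idempotent B \<theta> P}"

text \<open>The inequalities on \<open>i - j\<close> and \<open>j - i\<close> below are written additively, to avoid
  truncated subtraction.\<close>

definition circular_hessenberg :: "nat \<Rightarrow> (nat \<Rightarrow> 'b \<Rightarrow> 'b) \<Rightarrow> ('b \<Rightarrow> 'b) \<Rightarrow> bool" where
  "circular_hessenberg d E B \<longleftrightarrow>
     (\<forall>i\<le>d. \<forall>j\<le>d.
        (j + 1 < i \<or> (i + 1 < j \<and> j < i + d) \<longrightarrow> E i \<circ> B \<circ> E j = (\<lambda>_. 0)) \<and>
        (i = j + 1 \<or> j = i + d \<longrightarrow> E i \<circ> B \<circ> E j \<noteq> (\<lambda>_. 0)))"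

definition CH_system ::
  "nat \<Rightarrow> ('b \<Rightarrow> 'b) \<Rightarrow> (nat \<Rightarrow> 'b \<Rightarrow> 'b) \<Rightarrow> ('b \<Rightarrow> 'b) \<Rightarrow> (nat \<Rightarrow> 'b \<Rightarrow> 'b) \<Rightarrow> bool" where
  "CH_system d A E As Es \<longleftrightarrow>
     multiplicity_free A \<and> multiplicity_free As \<and>
     idempotent_ordering d A E \<and> idempotent_ordering d As Es \<and>
     circular_hessenberg d E As \<and> circular_hessenberg d Es A"

definition eigenvalue_sequence ::
  "nat \<Rightarrow> ('b \<Rightarrow> 'b) \<Rightarrow> (nat \<Rightarrow> 'b \<Rightarrow> 'b) \<Rightarrow> (nat \<Rightarrow> 'a) \<Rightarrow> bool" where
  "eigenvalue_sequence d B E \<theta> \<longleftrightarrow> (\<forall>i\<le>d. primitive_idempotent B (\<theta> i) (E i))"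

end

text \<open>Entries \<open>diag i\<close> at \<open>(i, i)\<close> and \<open>sub i\<close> at \<open>(i, i - 1)\<close>.\<close>

definition lower_bidiagonal :: "(nat \<Rightarrow> 'a::zero) \<Rightarrow> (nat \<Rightarrow> 'a) \<Rightarrow> nat \<Rightarrow> nat \<Rightarrow> 'a" where
  "lower_bidiagonal diag sub i j = (if j = i then diag i else if i = j + 1 then sub i else 0)"

text \<open>Entries \<open>diag i\<close> at \<open>(i, i)\<close> and \<open>super i\<close> at \<open>(i - 1, i)\<close>: the superdiagonal is indexed
  by the column.\<close>

definition upper_bidiagonal :: "(nat \<Rightarrow> 'a::zero) \<Rightarrow> (nat \<Rightarrow> 'a) \<Rightarrow> nat \<Rightarrow> nat \<Rightarrow> 'a" where
  "upper_bidiagonal diag super i j = (if j = i then diag i else if j = i + 1 then super j else 0)"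

context vector_space
begin

text \<open>For a CH system with eigenvalue sequence \<open>\<theta>\<close> and dual eigenvalue sequence \<open>\<theta>s\<close>,
  the values \<open>\<phi> 1, \<dots>, \<phi> d\<close> are uniquely determined by this property.\<close>

definition split_sequence ::
  "nat \<Rightarrow> ('b \<Rightarrow> 'b) \<Rightarrow> ('b \<Rightarrow> 'b) \<Rightarrow> (nat \<Rightarrow> 'a) \<Rightarrow> (nat \<Rightarrow> 'a) \<Rightarrow> (nat \<Rightarrow> 'a) \<Rightarrow> bool" where
  "split_sequence d A As \<theta> \<theta>s \<phi> \<longleftrightarrow>
     (\<forall>i\<in>{1..d}. \<phi> i \<noteq> 0) \<and>
     (\<exists>w. ordered_basis d w \<and>
        represents d w A (lower_bidiagonal (\<lambda>i. \<theta> (d - i)) (\<lambda>_. 1)) \<and>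
        represents d w As (upper_bidiagonal \<theta>s \<phi>))"

text \<open>\<open>(B - \<theta>s (d-i+1)) \<cdots> (B - \<theta>s (d-1)) (B - \<theta>s d) u\<close> for \<open>i \<le> d\<close>.\<close>

definition split_vector ::
  "nat \<Rightarrow> ('b \<Rightarrow> 'b) \<Rightarrow> (nat \<Rightarrow> 'a) \<Rightarrow> 'b \<Rightarrow> nat \<Rightarrow> 'b" where
  "split_vector d B \<theta>s u i = foldr (\<lambda>k v. B v - \<theta>s k *s v) [d - i + 1..<d + 1] u"

end

end

theory Submission
  imports Defs
begin

text \<open>Let \<open>w\<close> be a basis witnessing that \<open>\<phi>\<close> is the split sequence. The last basis vector \<open>w d\<close> spans
  the \<open>\<theta> 0\<close>-eigenspace of \<open>A\<close>, so \<open>u = c *s w d\<close> with \<open>c \<noteq> 0\<close>. Since \<open>As - \<theta>s j\<close> sends \<open>w j\<close> to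
  \<open>\<phi> j *s w (j - 1)\<close>, the vector \<open>vs (d - j)\<close> is \<open>c * \<phi> (j + 1) * \<dots> * \<phi> d\<close> times \<open>w j\<close>. This diagonal
  rescaling of \<open>w\<close> moves the entries \<open>\<phi>\<close> from the matrix of \<open>As\<close> to that of \<open>A\<close>.\<close>

context vector_space
begin

lemma ordered_basis_cong:
  assumes "\<And>j. j \<le> d \<Longrightarrow> v j = w j"
  shows "ordered_basis d v \<longleftrightarrow> ordered_basis d w"
proof -
  have "inj_on v {..d} \<longleftrightarrow> inj_on w {..d}" "v ` {..d} = w ` {..d}"
    using assms by (auto intro!: inj_on_cong image_cong)
  then show ?thesis by (simp add: ordered_basis_def)
qed

text \<open>For each \<open>j\<close>, the span of the \<open>w i\<close> with \<open>i\<close>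
  different from \<open>j\<close> contains all the other rescaled vectors but not the
  \<open>j\<close>-th one. This separation gives both injectivity and independence.\<close>

lemma ordered_basis_scale:
  assumes w: "ordered_basis d w" and c: "\<And>j. j \<le> d \<Longrightarrow> c j \<noteq> 0"
  shows "ordered_basis d (\<lambda>j. c j *s w j)"
proof -
  let ?v = "\<lambda>j. c j *s w j" and ?W = "w ` {..d}"
  have inj: "inj_on w {..d}" and ind: "independent ?W" and span: "span ?W = UNIV"
    using w by (auto simp: ordered_basis_def)
  have w_v: "w j = inverse (c j) *s ?v j" if "j \<le> d" for j
    using c[OF that] by simp
  have notin: "?v j \<notin> span (?W - {w j})" if "j \<le> d" for j
  proof
    assume "?v j \<in> span (?W - {w j})"
    then have "w j \<in> span (?W - {w j})"
      using w_v[OF that] by (metis span_scale)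
    then show False
      using ind that by (auto simp: dependent_def)
  qed
  have other: "?v i \<in> span (?W - {w j})" if "i \<le> d" "j \<le> d" "i \<noteq> j" for i j
    using that inj by (intro span_scale span_base) (auto simp: inj_on_def)
  have "inj_on ?v {..d}"
    using notin other unfolding inj_on_def by (metis atMost_iff)
  moreover have "independent (?v ` {..d})"
  proof
    assume "dependent (?v ` {..d})"
    then obtain j where j: "j \<le> d" "?v j \<in> span (?v ` {..d} - {?v j})"
      by (auto simp: dependent_def)
    \<comment> \<open>A vector \<open>?v i\<close> different from \<open>?v j\<close> has
      \<open>i\<close> different from \<open>j\<close>, so \<open>other\<close> applies.\<close>
    have "?v ` {..d} - {?v j} \<subseteq> span (?W - {w j})"
      using other j(1) by blast
    then have "span (?v ` {..d} - {?v j}) \<subseteq> span (?W - {w j})"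
      by (simp add: span_minimal)
    then show False
      using j notin by blast
  qed
  moreover have "span (?v ` {..d}) = UNIV"
  proof -
    have "?W \<subseteq> span (?v ` {..d})"
    proof
      fix x assume "x \<in> ?W"
      then obtain j where j: "j \<le> d" "x = w j" by auto
      then have "inverse (c j) *s ?v j \<in> span (?v ` {..d})"
        by (intro span_scale span_base) auto
      then show "x \<in> span (?v ` {..d})"
        using w_v j by metis
    qed
    then have "span ?W \<subseteq> span (?v ` {..d})"
      by (simp add: span_minimal)
    then show ?thesis using span by blast
  qed
  ultimately show ?thesis
    by (simp add: ordered_basis_def)
qed

lemma ordered_basis_nonzero:
  assumes "ordered_basis d w" "j \<le> d"
  shows "w j \<noteq> 0"
  using assms dependent_zero unfolding ordered_basis_def by (metis atMost_iff imageI)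

text \<open>Column \<open>j\<close> has at most two nonzero entries. The guard \<open>j < d\<close>
  is there because the last column has only its diagonal entry.\<close>

lemma represents_lower_bidiagonal:
  "represents d w B (lower_bidiagonal a b) \<longleftrightarrow>
     (\<forall>j\<le>d. B (w j) = a j *s w j + (if j < d then b (Suc j) *s w (Suc j) else 0))"
proof -
  have "(\<Sum>i\<le>d. lower_bidiagonal a b i j *s w i) =
      a j *s w j + (if j < d then b (Suc j) *s w (Suc j) else 0)" if "j \<le> d" for j
  proof -
    have "(\<Sum>i\<le>d. lower_bidiagonal a b i j *s w i) =
        (\<Sum>i\<le>d. (if i = j then a i *s w i else 0) + (if i = Suc j then b i *s w i else 0))"
      by (intro sum.cong) (auto simp: lower_bidiagonal_def)
    then show ?thesis
      using that by (simp add: sum.distrib Suc_le_eq)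
  qed
  then show ?thesis by (simp add: represents_def)
qed

lemma represents_upper_bidiagonal:
  "represents d w B (upper_bidiagonal a b) \<longleftrightarrow>
     (\<forall>j\<le>d. B (w j) = a j *s w j + (if 0 < j then b j *s w (j - 1) else 0))"
proof -
  have "(\<Sum>i\<le>d. upper_bidiagonal a b i j *s w i) =
      a j *s w j + (if 0 < j then b j *s w (j - 1) else 0)" if "j \<le> d" for j
  proof -
    \<comment> \<open>The inner test \<open>0 < j\<close> matters: at \<open>j = 0\<close> truncated
      subtraction gives \<open>j - 1 = 0\<close>, which would count row \<open>0\<close> a second
      time.\<close>
    have "(\<Sum>i\<le>d. upper_bidiagonal a b i j *s w i) =
        (\<Sum>i\<le>d. (if i = j then a i *s w i else 0) +
           (if i = j - 1 then (if 0 < j then b j *s w i else 0) else 0))"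
      by (intro sum.cong) (auto simp: upper_bidiagonal_def)
    moreover have "j - 1 \<le> d" using that by simp
    ultimately show ?thesis
      using that by (simp add: sum.distrib)
  qed
  then show ?thesis by (simp add: represents_def)
qed

text \<open>The definition prescribes \<open>P\<close> only on eigenvectors. By diagonalizability
  these span the space, and the \<theta>-eigenspace is closed under linear combinations, so
  induction over the span reaches every \<open>x\<close>.\<close>

lemma primitive_idempotent_in_eigenspace:
  assumes lin: "Vector_Spaces.linear scale scale B" and "diagonalizable B"
    and P: "primitive_idempotent B \<theta> P"
  shows "P x \<in> eigenspace B \<theta>"
proof -
  interpret B: Vector_Spaces.linear scale scale B by (rule lin)
  interpret P: Vector_Spaces.linear scale scale P
    using P by (simp add: primitive_idempotent_def)
  obtain S where S: "span S = UNIV" "\<And>v. v \<in> S \<Longrightarrow> \<exists>\<eta>. v \<in> eigenspace B \<eta>"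
    using \<open>diagonalizable B\<close> by (auto simp: diagonalizable_def)
  have "x \<in> span S" using S by simp
  then show ?thesis
  proof (induction rule: span_induct_alt)
    case base
    then show ?case by (simp add: eigenspace_def P.zero B.zero)
  next
    case (step c v y)
    obtain \<eta> where \<eta>: "v \<in> eigenspace B \<eta>" using S step by blast
    have "P v \<in> eigenspace B \<theta>"
    proof (cases "\<eta> = \<theta>")
      case True
      then show ?thesis using P \<eta> by (simp add: primitive_idempotent_def)
    next
      case False
      then have "P v = 0" using P \<eta> by (simp add: primitive_idempotent_def)
      then show ?thesis by (simp add: eigenspace_def B.zero)
    qed
    then show ?case
      using step by (simp add: eigenspace_def P.add P.scale B.add B.scale scale_right_distrib mult.commute)
  qed
qed

lemma dim_one_multiple:
  assumes "dim U = 1" "x \<in> U" "y \<in> U" "y \<noteq> 0"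
  obtains c where "x = c *s y"
proof -
  obtain S where S: "U \<subseteq> span S" "card S = dim U"
    using basis_exists by blast
  then obtain b where "S = {b}"
    using assms(1) by (auto simp: card_1_singleton_iff)
  then have "U \<subseteq> range (\<lambda>k. k *s b)"
    using S(1) by (simp add: span_singleton)
  then obtain p q where pq: "x = p *s b" "y = q *s b"
    using assms(2,3) by blast
  \<comment> \<open>The division is legitimate: \<open>y \<noteq> 0\<close> forces
    \<open>q \<noteq> 0\<close>.\<close>
  then have "x = (p / q) *s y" using assms(4) by auto
  then show thesis by (rule that)
qed

lemma split_vector_0: "split_vector d B \<theta>s u 0 = u"
  by (simp add: split_vector_def)

text \<open>\<open>foldr\<close> applies the factor with index \<open>d\<close> first, so the newest
  factor, with index \<open>d - i\<close>, is the head of the list.\<close>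

lemma split_vector_Suc:
  assumes "i < d"
  shows "split_vector d B \<theta>s u (Suc i) =
    B (split_vector d B \<theta>s u i) - \<theta>s (d - i) *s split_vector d B \<theta>s u i"
proof -
  have "[d - Suc i + 1..<d + 1] = [d - i..<d + 1]"
    using assms by (simp add: Suc_diff_Suc)
  also have "\<dots> = (d - i) # [d - i + 1..<d + 1]"
    using assms by (subst upt_conv_Cons) auto
  finally have "[d - Suc i + 1..<d + 1] = (d - i) # [d - i + 1..<d + 1]" .
  then show ?thesis by (simp add: split_vector_def)
qed

text \<open>Each factor cancels the diagonal term of its column and lowers the index by one. The
  product collects the superdiagonal entries passed on the way down from \<open>d\<close>.\<close>

lemma split_vector_upper_bidiagonal:
  assumes B: "Vector_Spaces.linear scale scale B"
    and rep: "represents d w B (upper_bidiagonal \<theta>s \<phi>)"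
    and "i \<le> d"
  shows "split_vector d B \<theta>s (c *s w d) i = (c * prod \<phi> {d - i<..d}) *s w (d - i)"
  using \<open>i \<le> d\<close>
proof (induction i)
  case 0
  then show ?case by (simp add: split_vector_0)
next
  case (Suc i)
  interpret B: Vector_Spaces.linear scale scale B by (rule B)
  define j where "j = d - i"
  have j: "0 < j" "j \<le> d" "d - Suc i = j - 1"
    using Suc.prems by (auto simp: j_def)
  have "{j - 1<..d} = insert j {j<..d}" using j by auto
  then have prod: "prod \<phi> {j - 1<..d} = \<phi> j * prod \<phi> {j<..d}" by simp
  have Bw: "B (w j) = \<theta>s j *s w j + \<phi> j *s w (j - 1)"
    using rep j by (simp add: represents_upper_bidiagonal)
  have IH: "split_vector d B \<theta>s (c *s w d) i = (c * prod \<phi> {j<..d}) *s w j"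
    using Suc by (simp add: j_def)
  have "split_vector d B \<theta>s (c *s w d) (Suc i) =
      B ((c * prod \<phi> {j<..d}) *s w j) - \<theta>s j *s (c * prod \<phi> {j<..d}) *s w j"
    using Suc.prems IH by (simp add: split_vector_Suc j_def)
  also have "\<dots> = (c * (\<phi> j * prod \<phi> {j<..d})) *s w (j - 1)"
    unfolding B.scale Bw by (simp add: scale_right_distrib mult_ac)
  finally show ?case
    by (simp only: j(3) prod)
qed

end

theorem lemma6p10:
  fixes scale :: "'f::field \<Rightarrow> 'v::ab_group_add \<Rightarrow> 'v"
    and d :: nat
    and A As :: "'v \<Rightarrow> 'v"
    and E Es :: "nat \<Rightarrow> 'v \<Rightarrow> 'v"
    and \<theta> \<theta>s \<phi> :: "nat \<Rightarrow> 'f"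
    and u :: 'v
    and vs :: "nat \<Rightarrow> 'v"
  assumes "vector_space scale"
    and "d \<ge> 3"
    and "vector_space.dim scale (UNIV :: 'v set) = d + 1"
    and "vector_space.CH_system scale d A E As Es"
    and "vector_space.eigenvalue_sequence scale d A E \<theta>"
    and "vector_space.eigenvalue_sequence scale d As Es \<theta>s"
    and "vector_space.split_sequence scale d A As \<theta> \<theta>s \<phi>"
    and "u \<in> range (E 0)" and "u \<noteq> 0"
    and "\<And>i. i \<le> d \<Longrightarrow> vs i = vector_space.split_vector scale d As \<theta>s u i"
  shows "vector_space.ordered_basis scale d (\<lambda>i. vs (d - i)) \<and>
    vector_space.represents scale d (\<lambda>i. vs (d - i)) A
      (lower_bidiagonal (\<lambda>i. \<theta> (d - i)) \<phi>) \<and>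
    vector_space.represents scale d (\<lambda>i. vs (d - i)) As
      (upper_bidiagonal \<theta>s (\<lambda>_. 1))"
proof -
  interpret vector_space scale by fact
  have A: "Vector_Spaces.linear scale scale A" "diagonalizable A"
    and As: "Vector_Spaces.linear scale scale As"
    and dim_eig: "\<And>\<eta>. eigenvalue A \<eta> \<Longrightarrow> dim (eigenspace A \<eta>) = 1"
    using assms(4) by (auto simp: CH_system_def multiplicity_free_def)
  interpret A: Vector_Spaces.linear scale scale A by (rule A)
  interpret As: Vector_Spaces.linear scale scale As by (rule As)
  have E0: "primitive_idempotent A (\<theta> 0) (E 0)"
    using assms(5) by (simp add: eigenvalue_sequence_def)
  obtain w where w: "ordered_basis d w"
    and wA: "represents d w A (lower_bidiagonal (\<lambda>i. \<theta> (d - i)) (\<lambda>_. 1))"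
    and wAs: "represents d w As (upper_bidiagonal \<theta>s \<phi>)"
    and \<phi>: "\<And>i. i \<in> {1..d} \<Longrightarrow> \<phi> i \<noteq> 0"
    using assms(7) by (auto simp: split_sequence_def)
  have "u \<in> eigenspace A (\<theta> 0)"
    using primitive_idempotent_in_eigenspace[OF A E0] assms(8) by auto
  \<comment> \<open>The last column of a lower bidiagonal matrix is purely diagonal, here with entry
    \<open>\<theta> (d - d)\<close>.\<close>
  moreover have "w d \<in> eigenspace A (\<theta> 0)"
    using wA by (simp add: represents_lower_bidiagonal eigenspace_def)
  moreover have "dim (eigenspace A (\<theta> 0)) = 1"
    using E0 dim_eig by (simp add: primitive_idempotent_def)
  ultimately obtain c where c: "u = scale c (w d)"
    using dim_one_multiple ordered_basis_nonzero[OF w] by blast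
  with \<open>u \<noteq> 0\<close> have "c \<noteq> 0" by auto
  define k where "k j = c * prod \<phi> {j<..d}" for j
  \<comment> \<open>The index set \<open>{j<..d}\<close> lies in \<open>{1..d}\<close>, where \<phi>
    does not vanish.\<close>
  have k_nz: "k j \<noteq> 0" for j
    using \<open>c \<noteq> 0\<close> \<phi> by (auto simp: k_def)
  have k_Suc: "k j = \<phi> (Suc j) * k (Suc j)" if "j < d" for j
  proof -
    have "{j<..d} = insert (Suc j) {Suc j<..d}" using that by auto
    then show ?thesis by (simp add: k_def)
  qed
  have v: "vs (d - j) = scale (k j) (w j)" if "j \<le> d" for j
    using split_vector_upper_bidiagonal[OF As wAs, of "d - j" c] assms(10)[of "d - j"] that
    by (simp add: c k_def)
  have "ordered_basis d (\<lambda>j. scale (k j) (w j))"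
    using w k_nz by (rule ordered_basis_scale)
  then have "ordered_basis d (\<lambda>j. vs (d - j))"
    using ordered_basis_cong[of d "\<lambda>j. vs (d - j)" "\<lambda>j. scale (k j) (w j)"] v by simp
  moreover have "represents d (\<lambda>i. vs (d - i)) A (lower_bidiagonal (\<lambda>i. \<theta> (d - i)) \<phi>)"
    unfolding represents_lower_bidiagonal
  proof (intro allI impI)
    fix j assume j: "j \<le> d"
    have "A (w j) = scale (\<theta> (d - j)) (w j) + (if j < d then w (Suc j) else 0)"
      using wA j by (simp add: represents_lower_bidiagonal)
    \<comment> \<open>The subdiagonal term has coefficient \<open>k j\<close>, which is
      \<open>\<phi> (Suc j)\<close> times the scaling factor of \<open>w (Suc j)\<close>.\<close>
    then show "A (vs (d - j)) = scale (\<theta> (d - j)) (vs (d - j)) +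
        (if j < d then scale (\<phi> (Suc j)) (vs (d - Suc j)) else 0)"
      using j by (simp add: v A.scale scale_right_distrib k_Suc mult_ac)
  qed
  moreover have "represents d (\<lambda>i. vs (d - i)) As (upper_bidiagonal \<theta>s (\<lambda>_. 1))"
    unfolding represents_upper_bidiagonal
  proof (intro allI impI)
    fix j assume j: "j \<le> d"
    have "As (w j) = scale (\<theta>s j) (w j) + (if 0 < j then scale (\<phi> j) (w (j - 1)) else 0)"
      using wAs j by (simp add: represents_upper_bidiagonal)
    \<comment> \<open>Here \<open>k j * \<phi> j = k (j - 1)\<close> for positive \<open>j\<close>,
      so \<phi> is absorbed into the rescaled vector. The instance \<open>v[of 0]\<close> serves
      \<open>j = 0\<close>, where \<open>d - 0\<close> simplifies to \<open>d\<close> and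
      \<open>v\<close> no longer matches.\<close>
    then show "As (vs (d - j)) = scale (\<theta>s j) (vs (d - j)) +
        (if 0 < j then scale 1 (vs (d - (j - 1))) else 0)"
      using j v[of 0]
      by (cases j) (simp_all add: v k_Suc As.scale scale_right_distrib mult_ac del: diff_Suc_Suc)
  qed
  ultimately show ?thesis by blast
qed

end
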